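(* Let $X$ be a nonempty set, $d$ a partial metric on $X$, and $e(x,y)=2d(x,y)-d(x,x)-d(y,y)$ its associated metric; assume that $(X,e)$ is complete. Let $T:X\to X$ be a map and let $\varphi:\mathbb{R}_+\to\mathbb{R}_+$ be a limit normal function such that $\psi(t):=t-\varphi(t)$ is semi-coercive. Suppose that $$d(Tx,Ty)\le \max\{\varphi(M(x,y)),\,b(x,y)\}\quad\text{for all }x,y\in X,$$ where $b(x,y)=\tfrac12(d(x,x)+d(y,y))$. Then $\{z\in X;\ z=Tz\}$ is a nonempty singleton; i.e., $T$ has a unique fixed point in $X$.
   Context: $\mathbb{R}_+=[0,\infty[$. A partial metric on $X$ is a map $d:X\times X\to\mathbb{R}_+$ such that for all $x,y,z\in X$: $d(x,y)=d(y,x)$; $d(x,z)\le d(x,y)+d(y,z)-d(y,y)$; $\max\{d(x,x),d(y,y)\}\le d(x,y)$; and $d(x,y)=d(x,x)=d(y,y)$ implies $x=y$. The function $e(x,y)=2d(x,y)-d(x,x)-d(y,y)$ is then a (standard) metric on $X$. For $x,y\in X$ put $M_1(x,y)=\max\{d(x,y),d(x,Tx),d(y,Ty)\}$, $M_2(x,y)=\tfrac12[d(x,Ty)+d(Tx,y)]$, and $M(x,y)=\max\{M_1(x,y),M_2(x,y)\}$. A function $\varphi:\mathbb{R}_+\to\mathbb{R}_+$ is normal if $\varphi(0)=0$ and $\varphi(t)<t$ for all $t>0$. It is limit normal if it is normal and $\limsup_{t\to s}\varphi(t)<s$ for all $s>0$, where $\limsup_{t\to s}\varphi(t)=\inf_{\varepsilon>0}\sup\{\varphi(t);\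 t\in\mathbb{R}_+,\ s-\varepsilon<t<s+\varepsilon\}$ (the value at $t=s$ is included). A function $\psi:\mathbb{R}_+\to\mathbb{R}_+$ is semi-coercive if $\liminf_{t\to\infty}\psi(t)>0$, where $\liminf_{t\to\infty}\psi(t)=\sup_{\alpha\ge0}\inf\{\psi(t);\ t\ge\alpha\}$. *)

theory Defs
  imports "HOL-Analysis.Analysis"
begin

locale Partial_metric_space =
  fixes X :: "'a set" and d :: "'a \<Rightarrow> 'a \<Rightarrow> real"
  assumes nonneg: "\<lbrakk>x \<in> X; y \<in> X\<rbrakk> \<Longrightarrow> 0 \<le> d x y"
    and commute: "\<lbrakk>x \<in> X; y \<in> X\<rbrakk> \<Longrightarrow> d x y = d y x"
    and triangle: "\<lbrakk>x \<in> X; y \<in> X; z \<in> X\<rbrakk> \<Longrightarrow> d x z \<le> d x y + d y z - d y y"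
    and small_self: "\<lbrakk>x \<in> X; y \<in> X\<rbrakk> \<Longrightarrow> max (d x x) (d y y) \<le> d x y"
    and eq_self: "\<lbrakk>x \<in> X; y \<in> X; d x y = d x x; d x y = d y y\<rbrakk> \<Longrightarrow> x = y"

text \<open>The locale \<^locale>\<open>Metric_space\<close> requires nonnegativity and symmetry also outside the
  carrier, where nothing is known about \<open>d\<close>; hence the value \<open>0\<close> there.\<close>

definition assoc_metric :: "'a set \<Rightarrow> ('a \<Rightarrow> 'a \<Rightarrow> real) \<Rightarrow> 'a \<Rightarrow> 'a \<Rightarrow> real" where
  "assoc_metric X d x y = (if x \<in> X \<and> y \<in> X then 2 * d x y - d x x - d y y else 0)"

lemma (in Partial_metric_space) Metric_space_assoc_metric: "Metric_space X (assoc_metric X d)"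
proof
  fix x y
  show "0 \<le> assoc_metric X d x y"
    using small_self[of x y] by (auto simp: assoc_metric_def)
  show "assoc_metric X d x y = assoc_metric X d y x"
    using commute[of x y] by (auto simp: assoc_metric_def)
next
  fix x y assume "x \<in> X" "y \<in> X"
  then show "assoc_metric X d x y = 0 \<longleftrightarrow> x = y"
    using small_self[of x y] eq_self[of x y] by (auto simp: assoc_metric_def)
next
  fix x y z assume "x \<in> X" "y \<in> X" "z \<in> X"
  then show "assoc_metric X d x z \<le> assoc_metric X d x y + assoc_metric X d y z"
    using triangle[of x y z] by (auto simp: assoc_metric_def)
qed

definition contr_M1 :: "('a \<Rightarrow> 'a \<Rightarrow> real) \<Rightarrow> ('a \<Rightarrow> 'a) \<Rightarrow> 'a \<Rightarrow> 'a \<Rightarrow> real" where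
  "contr_M1 d T x y = Max {d x y, d x (T x), d y (T y)}"

definition contr_M2 :: "('a \<Rightarrow> 'a \<Rightarrow> real) \<Rightarrow> ('a \<Rightarrow> 'a) \<Rightarrow> 'a \<Rightarrow> 'a \<Rightarrow> real" where
  "contr_M2 d T x y = (d x (T y) + d (T x) y) / 2"

definition contr_M :: "('a \<Rightarrow> 'a \<Rightarrow> real) \<Rightarrow> ('a \<Rightarrow> 'a) \<Rightarrow> 'a \<Rightarrow> 'a \<Rightarrow> real" where
  "contr_M d T x y = max (contr_M1 d T x y) (contr_M2 d T x y)"

definition self_mean :: "('a \<Rightarrow> 'a \<Rightarrow> real) \<Rightarrow> 'a \<Rightarrow> 'a \<Rightarrow> real" where
  "self_mean d x y = (d x x + d y y) / 2"

text \<open>A self-map of \<open>[0, \<infinity>[\<close> is a function on the reals of which only the restriction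
  to \<open>{0..}\<close> matters.\<close>

definition normal_fun :: "(real \<Rightarrow> real) \<Rightarrow> bool" where
  "normal_fun \<phi> \<longleftrightarrow> \<phi> \<in> {0..} \<rightarrow> {0..} \<and> \<phi> 0 = 0 \<and> (\<forall>t>0. \<phi> t < t)"

text \<open>The upper limit includes the value at \<open>s\<close>, so the filter is not \<open>at s within {0..}\<close>.\<close>

definition limsup_at :: "real \<Rightarrow> (real \<Rightarrow> real) \<Rightarrow> ereal" where
  "limsup_at s \<phi> = Limsup (inf (nhds s) (principal {0..})) (\<lambda>t. ereal (\<phi> t))"

lemma limsup_at_eq:
  "limsup_at s \<phi> = (INF \<epsilon>\<in>{0<..}. SUP t\<in>{t. 0 \<le> t \<and> s - \<epsilon> < t \<and> t < s + \<epsilon>}. ereal (\<phi> t))"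
  unfolding limsup_at_def
proof (rule antisym)
  show "Limsup (inf (nhds s) (principal {0..})) (\<lambda>t. ereal (\<phi> t))
      \<le> (INF \<epsilon>\<in>{0<..}. SUP t\<in>{t. 0 \<le> t \<and> s - \<epsilon> < t \<and> t < s + \<epsilon>}. ereal (\<phi> t))"
    unfolding Limsup_def
  proof (rule INF_mono)
    fix \<epsilon> :: real assume "\<epsilon> \<in> {0<..}"
    then have "eventually (\<lambda>t. 0 \<le> t \<and> s - \<epsilon> < t \<and> t < s + \<epsilon>)
        (inf (nhds s) (principal {0..}))"
      unfolding eventually_inf_principal eventually_nhds_metric
      by (intro exI[of _ \<epsilon>]) (auto simp: dist_real_def)
    then show "\<exists>P\<in>{P. eventually P (inf (nhds s) (principal {0..}))}.
        (SUP t\<in>{t. P t}. ereal (\<phi> t))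
        \<le> (SUP t\<in>{t. 0 \<le> t \<and> s - \<epsilon> < t \<and> t < s + \<epsilon>}. ereal (\<phi> t))"
      by blast
  qed
  show "(INF \<epsilon>\<in>{0<..}. SUP t\<in>{t. 0 \<le> t \<and> s - \<epsilon> < t \<and> t < s + \<epsilon>}. ereal (\<phi> t))
      \<le> Limsup (inf (nhds s) (principal {0..})) (\<lambda>t. ereal (\<phi> t))"
    unfolding Limsup_def
  proof (rule INF_mono)
    fix P assume "P \<in> {P. eventually P (inf (nhds s) (principal {0::real..}))}"
    then obtain \<epsilon> where \<epsilon>: "\<epsilon> > 0" "\<And>t. dist t s < \<epsilon> \<Longrightarrow> 0 \<le> t \<Longrightarrow> P t"
      by (auto simp: eventually_inf_principal eventually_nhds_metric)
    have "{t. 0 \<le> t \<and> s - \<epsilon> < t \<and> t < s + \<epsilon>} \<subseteq> {t. P t}"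
      using \<epsilon>(2) by (auto simp: dist_real_def)
    with \<epsilon>(1) show "\<exists>\<epsilon>\<in>{0<..}. (SUP t\<in>{t. 0 \<le> t \<and> s - \<epsilon> < t \<and> t < s + \<epsilon>}. ereal (\<phi> t))
        \<le> (SUP t\<in>{t. P t}. ereal (\<phi> t))"
      by (intro bexI[of _ \<epsilon>] SUP_subset_mono) auto
  qed
qed

definition limit_normal :: "(real \<Rightarrow> real) \<Rightarrow> bool" where
  "limit_normal \<phi> \<longleftrightarrow> normal_fun \<phi> \<and> (\<forall>s>0. limsup_at s \<phi> < ereal s)"

definition semi_coercive :: "(real \<Rightarrow> real) \<Rightarrow> bool" where
  "semi_coercive \<psi> \<longleftrightarrow> \<psi> \<in> {0..} \<rightarrow> {0..} \<and> Liminf at_top (\<lambda>t. ereal (\<psi> t)) > 0"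

lemma Liminf_at_top_eq:
  fixes \<psi> :: "real \<Rightarrow> real"
  shows "Liminf at_top (\<lambda>t. ereal (\<psi> t)) = (SUP \<alpha>\<in>{0..}. INF t\<in>{\<alpha>..}. ereal (\<psi> t))"
  unfolding Liminf_def
proof (rule antisym)
  show "(SUP P\<in>{P. eventually P at_top}. INF t\<in>{t. P t}. ereal (\<psi> t))
      \<le> (SUP \<alpha>\<in>{0..}. INF t\<in>{\<alpha>..}. ereal (\<psi> t))"
  proof (rule SUP_mono)
    fix P assume "P \<in> {P. eventually P (at_top :: real filter)}"
    then obtain \<beta> where "\<And>t. t \<ge> \<beta> \<Longrightarrow> P t"
      by (auto simp: eventually_at_top_linorder)
    then have "{max 0 \<beta>..} \<subseteq> {t. P t}"
      by auto
    then show "\<exists>\<alpha>\<in>{0..}. (INF t\<in>{t. P t}. ereal (\<psi> t)) \<le> (INF t\<in>{\<alpha>..}. ereal (\<psi> t))"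
      by (intro bexI[of _ "max 0 \<beta>"] INF_superset_mono) auto
  qed
  show "(SUP \<alpha>\<in>{0..}. INF t\<in>{\<alpha>..}. ereal (\<psi> t))
      \<le> (SUP P\<in>{P. eventually P at_top}. INF t\<in>{t. P t}. ereal (\<psi> t))"
  proof (rule SUP_mono)
    fix \<alpha> :: real
    show "\<exists>P\<in>{P. eventually P at_top}. (INF t\<in>{\<alpha>..}. ereal (\<psi> t)) \<le> (INF t\<in>{t. P t}. ereal (\<psi> t))"
      by (intro bexI[of _ "\<lambda>t. \<alpha> \<le> t"]) (auto simp: atLeast_def eventually_ge_at_top)
  qed
qed

end

theory Submission
  imports Defs
begin

text \<open>The two hypotheses on \<open>\<phi>\<close> combine to a uniform gap: \<open>t - \<phi> t\<close> is bounded away from \<open>0\<close>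
  on every half-line \<open>[\<delta>, \<infinity>[\<close> with \<open>\<delta> > 0\<close>. Let \<open>\<rho>\<close> be the infimum of \<open>d x (T x)\<close>. Along an
  orbit, \<open>d x\<^sub>n x\<^sub>n\<^sub>+\<^sub>1\<close> decreases to a limit, which the gap forces to be the limit of \<open>d x\<^sub>n x\<^sub>n\<close>
  as well; hence there are points for which \<open>d x x\<close>, \<open>d (T x) (T x)\<close> and \<open>d x (T x)\<close> are all
  as close to \<open>\<rho>\<close> as desired. By the gap, a sequence of better and better such points is Cauchy,
  and its limit \<open>u\<close> satisfies \<open>d u u = d u (T u) = \<rho>\<close>. Applying the contraction condition to
  \<open>u\<close> and \<open>T u\<close>, and the minimality of \<open>\<rho>\<close> at \<open>T u\<close>, yields \<open>d (T u) (T u) = \<rho>\<close>, so that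
  \<open>T u = u\<close>.\<close>

section \<open>The uniform gap below the identity\<close>

lemma limit_normal_gap:
  assumes \<phi>: "limit_normal \<phi>" and \<psi>: "semi_coercive (\<lambda>t. t - \<phi> t)" and "\<delta> > 0"
  obtains \<eta> where "\<eta> > 0" "\<And>t. t \<ge> \<delta> \<Longrightarrow> \<phi> t \<le> t - \<eta>"
proof -
  \<comment> \<open>Otherwise there are points \<open>t n \<ge> \<delta>\<close> whose gaps tend to
    \<open>0\<close>. Semi-coercivity keeps them bounded from some index on, so they accumulate at
    some \<open>s > 0\<close>, against the upper limit condition there.\<close>
  have "\<exists>\<eta>>0. \<forall>t\<ge>\<delta>. \<phi> t \<le> t - \<eta>"
  proof (rule ccontr)
    assume no: "\<not> ?thesis"
    have "\<exists>t\<ge>\<delta>. t - \<phi> t < inverse (real (Suc n))" for n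
    proof -
      have "inverse (real (Suc n)) > 0" by simp
      with no obtain t where "t \<ge> \<delta>" "\<not> \<phi> t \<le> t - inverse (real (Suc n))" by blast
      then show ?thesis by (intro exI[of _ t]) linarith
    qed
    then obtain t where t: "\<And>n. t n \<ge> \<delta>" "\<And>n. t n - \<phi> (t n) < inverse (real (Suc n))"
      by metis
    have small: "\<forall>\<^sub>F n in sequentially. t n - \<phi> (t n) < \<eta>" if "\<eta> > 0" for \<eta>
      using order_tendstoD(2)[OF LIMSEQ_inverse_real_of_nat that]
      by eventually_elim (rule less_trans[OF t(2)])
    obtain c where c: "0 < ereal c" "ereal c < Liminf at_top (\<lambda>t. ereal (t - \<phi> t))"
      using \<psi> unfolding semi_coercive_def by (metis ereal_dense2)
    then have "\<forall>\<^sub>F s in at_top. ereal c < ereal (s - \<phi> s)"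
      using less_LiminfD by blast
    then obtain \<alpha> where \<alpha>: "\<And>s. s \<ge> \<alpha> \<Longrightarrow> c < s - \<phi> s"
      by (auto simp: eventually_at_top_linorder)
    obtain N where N: "\<And>n. n \<ge> N \<Longrightarrow> t n - \<phi> (t n) < c"
      using small[of c] c(1) by (auto simp: eventually_sequentially)
    have "t (n + N) \<in> {\<delta>..\<alpha>}" for n
      using \<alpha>[of "t (n + N)"] N[of "n + N"] t(1)[of "n + N"] by force
    then obtain s r where s: "s \<in> {\<delta>..\<alpha>}" "strict_mono r"
        "((\<lambda>n. t (n + N)) \<circ> r) \<longlonglongrightarrow> s"
      using seq_compactE[OF compact_imp_seq_compact[OF compact_Icc]] by metis
    then have "s > 0"
      using \<open>\<delta> > 0\<close> by auto
    define u where "u = (\<lambda>n. t (r n + N))"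
    have u: "u \<longlonglongrightarrow> s"
      using s(3) by (simp add: u_def o_def)
    have "0 \<le> u n" for n
      using t(1)[of "r n + N"] \<open>\<delta> > 0\<close> by (simp add: u_def)
    with u have lim: "filterlim u (inf (nhds s) (principal {0..})) sequentially"
      by (simp add: filterlim_inf filterlim_principal)
    \<comment> \<open>Near \<open>s\<close>, \<open>\<phi>\<close> stays below \<open>c'\<close>
      while \<open>u n\<close> exceeds the midpoint of \<open>c'\<close> and \<open>s\<close>, which
      leaves a gap of more than \<open>(s - c') / 2\<close>.\<close>
    obtain c' where c': "limsup_at s \<phi> < ereal c'" "ereal c' < ereal s"
      using \<phi> \<open>s > 0\<close> unfolding limit_normal_def by (metis ereal_dense2)
    have "\<forall>\<^sub>F x in inf (nhds s) (principal {0..}). ereal (\<phi> x) < ereal c'"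
      using c'(1) unfolding limsup_at_def by (rule Limsup_lessD)
    then have 1: "\<forall>\<^sub>F n in sequentially. \<phi> (u n) < c'"
      using lim unfolding filterlim_iff by auto
    have 2: "\<forall>\<^sub>F n in sequentially. u n > (s + c') / 2"
      using u by (rule order_tendstoD) (use c'(2) in auto)
    have "filterlim (\<lambda>n. r n + N) sequentially sequentially"
      using filterlim_subseq[OF s(2)]
      by (intro filterlim_compose[OF filterlim_add_const_nat_at_top])
    from eventually_compose_filterlim[OF small[of "(s - c') / 2"] this]
    have 3: "\<forall>\<^sub>F n in sequentially. u n - \<phi> (u n) < (s - c') / 2"
      using c'(2) by (simp add: u_def)
    from 1 2 3 have "\<forall>\<^sub>F n in sequentially. False"
      by eventually_elim (simp add: field_simps)
    then show False
      by simp
  qed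
  with that show thesis
    by blast
qed

section \<open>The contraction condition along an orbit\<close>

locale Partial_metric_contraction = Partial_metric_space X d
  for X :: "'a set" and d :: "'a \<Rightarrow> 'a \<Rightarrow> real" +
  fixes T :: "'a \<Rightarrow> 'a" and \<phi> :: "real \<Rightarrow> real"
  assumes nonempty: "X \<noteq> {}"
    and self_map: "T \<in> X \<rightarrow> X"
    and limit_normal: "limit_normal \<phi>"
    and semi_coercive: "semi_coercive (\<lambda>t. t - \<phi> t)"
    and contraction: "\<lbrakk>x \<in> X; y \<in> X\<rbrakk> \<Longrightarrow>
      d (T x) (T y) \<le> max (\<phi> (contr_M d T x y)) (self_mean d x y)"
begin

lemma T_in [simp]: "x \<in> X \<Longrightarrow> T x \<in> X"
  using self_map by auto

lemma self_le: "\<lbrakk>x \<in> X; y \<in> X\<rbrakk> \<Longrightarrow> d x x \<le> d x y" "\<lbrakk>x \<in> X; y \<in> X\<rbrakk> \<Longrightarrow> d y y \<le> d x y"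
  using small_self[of x y] by auto

lemma gap:
  assumes "\<delta> > 0"
  obtains \<eta> where "\<eta> > 0" "\<And>t. t \<ge> \<delta> \<Longrightarrow> \<phi> t \<le> t - \<eta>"
  using limit_normal_gap[OF limit_normal semi_coercive assms] by blast

lemma \<phi>_less: "t > 0 \<Longrightarrow> \<phi> t < t"
  using limit_normal by (auto simp: limit_normal_def normal_fun_def)

lemma \<phi>_0: "\<phi> 0 = 0"
  using limit_normal by (auto simp: limit_normal_def normal_fun_def)

text \<open>The subtracted self-distance in the triangle inequality through \<open>T x\<close>
  cancels the one in \<open>contr_M2\<close>, which is therefore at most the mean of two consecutive
  steps.\<close>

lemma contr_M_iterate:
  assumes "x \<in> X"
  shows "contr_M d T x (T x) = max (d x (T x)) (d (T x) (T (T x)))"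
  using triangle[of x "T x" "T (T x)"] assms
  by (auto simp: contr_M_def contr_M1_def contr_M2_def)

text \<open>Were the second step longer, it would equal \<open>contr_M d T x (T x)\<close>; its
  image under \<open>\<phi>\<close> and the self-mean, which is at most \<open>d x (T x)\<close>,
  would both lie strictly below it.\<close>

lemma iterate_antimono:
  assumes "x \<in> X"
  shows "d (T x) (T (T x)) \<le> d x (T x)"
  using contraction[of x "T x"] contr_M_iterate[OF assms] assms
    \<phi>_less[of "d (T x) (T (T x))"] nonneg[of x "T x"] self_le[of x "T x"]
  by (fastforce simp: self_mean_def max_def split: if_splits)

lemma iterate_contraction:
  assumes "x \<in> X"
  shows "d (T x) (T (T x)) \<le> max (\<phi> (d x (T x))) (self_mean d x (T x))"
  using contraction[of x "T x"] contr_M_iterate[OF assms] iterate_antimono[OF assms] assms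
  by (simp add: max_absorb1)

section \<open>Limits of step lengths and self-distances\<close>

definition \<rho> :: real where
  "\<rho> = (INF x\<in>X. d x (T x))"

lemma \<rho>_le: "x \<in> X \<Longrightarrow> \<rho> \<le> d x (T x)"
  unfolding \<rho>_def by (rule cINF_lower) (auto intro!: bdd_belowI[of _ 0] nonneg)

lemma \<rho>_nonneg: "0 \<le> \<rho>"
  unfolding \<rho>_def using nonempty by (intro cINF_greatest) (auto intro: nonneg)

lemma orbit_limit:
  assumes "x \<in> X"
  obtains r where "\<rho> \<le> r" "r \<le> d x (T x)"
    "(\<lambda>n. d ((T ^^ n) x) ((T ^^ Suc n) x)) \<longlonglongrightarrow> r" "(\<lambda>n. d ((T ^^ n) x) ((T ^^ n) x)) \<longlonglongrightarrow> r"
proof -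
  define y where "y n = (T ^^ n) x" for n
  define s where "s n = d (y n) (y (Suc n))" for n
  have y: "y n \<in> X" "y (Suc n) = T (y n)" for n
    by (induction n) (use assms in \<open>auto simp: y_def\<close>)
  have mono: "decseq s"
    using iterate_antimono y by (auto simp: decseq_Suc_iff s_def)
  have \<rho>: "\<rho> \<le> s n" for n
    using \<rho>_le y by (simp add: s_def)
  obtain r where r: "s \<longlonglongrightarrow> r" "\<And>n. r \<le> s n"
    using decseq_convergent[OF mono, of \<rho>] \<rho> by blast
  have self: "0 \<le> d (y n) (y n)" "d (y n) (y n) \<le> s n" for n
    using nonneg self_le y(1) by (auto simp: s_def)
  have "\<rho> \<le> r"
    using r(1) \<rho> by (auto intro: LIMSEQ_le_const)
  have "(\<lambda>n. d (y n) (y n)) \<longlonglongrightarrow> r"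
  proof (cases "r > 0")
    case False
    with \<open>\<rho> \<le> r\<close> \<rho>_nonneg have "r = 0" by simp
    with r(1) have "(\<lambda>_. 0) \<longlonglongrightarrow> r" "s \<longlonglongrightarrow> r" by simp_all
    then show ?thesis
      by (rule tendsto_sandwich[rotated 2]) (simp_all add: self)
  next
    case True
    obtain \<eta> where \<eta>: "\<eta> > 0" "\<And>t. t \<ge> r \<Longrightarrow> \<phi> t \<le> t - \<eta>"
      using gap[OF True] by blast
    have "\<forall>\<^sub>F n in sequentially. s n < r + \<eta>"
      using r(1) by (rule order_tendstoD) (use \<eta> in auto)
    then have lower: "\<forall>\<^sub>F n in sequentially. s (Suc n) \<le> d (y n) (y n)"
    proof eventually_elim
      case (elim n)
      have "s (Suc n) \<le> max (\<phi> (s n)) (self_mean d (y n) (y (Suc n)))"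
        using iterate_contraction[OF y(1)[of n]] by (simp add: s_def y(2))
      \<comment> \<open>Hence the self-mean bounds \<open>s (Suc n)\<close>. One of its two entries
        is at most \<open>s (Suc n)\<close>, so the other, \<open>d (y n) (y n)\<close>, is at least
        \<open>s (Suc n)\<close>.\<close>
      moreover have "\<phi> (s n) < s (Suc n)"
        using \<eta>(2)[OF r(2)[of n]] elim r(2)[of "Suc n"] by linarith
      ultimately show ?case
        using self(2)[of "Suc n"] by (simp add: self_mean_def max_def split: if_splits)
    qed
    show ?thesis
      by (rule tendsto_sandwich[OF lower _ LIMSEQ_Suc[OF r(1)] r(1)]) (use self in auto)
  qed
  with that[OF \<open>\<rho> \<le> r\<close>] r show thesis
    using r(2)[of 0] by (simp add: s_def[abs_def] y_def)
qed

section \<open>Near-minimal points\<close>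

definition near_minimal :: "real \<Rightarrow> 'a \<Rightarrow> bool" where
  "near_minimal h x \<longleftrightarrow> x \<in> X \<and> \<bar>d x x - \<rho>\<bar> \<le> h \<and> \<bar>d (T x) (T x) - \<rho>\<bar> \<le> h
     \<and> \<bar>d x (T x) - \<rho>\<bar> \<le> h"

lemma near_minimalD:
  assumes "near_minimal h x"
  shows "x \<in> X" "\<rho> - h \<le> d x x" "d x x \<le> \<rho> + h" "\<rho> - h \<le> d (T x) (T x)"
    "d (T x) (T x) \<le> \<rho> + h" "d x (T x) \<le> \<rho> + h"
  using assms by (auto simp: near_minimal_def)

lemma near_minimal_mono: "\<lbrakk>near_minimal h x; h \<le> h'\<rbrakk> \<Longrightarrow> near_minimal h' x"
  by (auto simp: near_minimal_def)

lemma near_minimal_exists: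
  assumes "h > 0"
  shows "\<exists>x. near_minimal h x"
proof -
  have "\<exists>x\<in>X. d x (T x) < \<rho> + h"
    using cInf_lessD[of "(\<lambda>x. d x (T x)) ` X" "\<rho> + h"] nonempty assms
    unfolding \<rho>_def by simp
  then obtain x where x: "x \<in> X" "d x (T x) < \<rho> + h" by blast
  obtain r where r: "\<rho> \<le> r" "r \<le> d x (T x)"
      and lim: "(\<lambda>n. d ((T ^^ n) x) ((T ^^ Suc n) x)) \<longlonglongrightarrow> r" "(\<lambda>n. d ((T ^^ n) x) ((T ^^ n) x)) \<longlonglongrightarrow> r"
    using orbit_limit[OF x(1)] .
  have close: "\<forall>\<^sub>F n in sequentially. \<bar>f n - \<rho>\<bar> \<le> h" if "f \<longlonglongrightarrow> r" for f
  proof -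
    have "\<forall>\<^sub>F n in sequentially. \<rho> - h < f n" "\<forall>\<^sub>F n in sequentially. f n < \<rho> + h"
      using r x(2) assms by (auto intro: order_tendstoD[OF that])
    then show ?thesis
      by eventually_elim (simp add: abs_le_iff)
  qed
  have "\<forall>\<^sub>F n in sequentially. near_minimal h ((T ^^ n) x)"
    \<comment> \<open>The limit shifted by one index controls the self-distance of the image of an
      orbit point.\<close>
    using close[OF lim(1)] close[OF lim(2)] close[OF LIMSEQ_Suc[OF lim(2)]]
  proof eventually_elim
    case (elim n)
    have "(T ^^ n) x \<in> X"
      by (induction n) (use x in auto)
    with elim show ?case
      by (simp add: near_minimal_def)
  qed
  then show ?thesis
    by (auto simp: eventually_sequentially)
qed

text \<open>Near-minimal points almost agree with their images, so \<open>contr_M d T x y\<close>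
  and \<open>d (T x) (T y)\<close> are both \<open>d x y\<close> up to multiples of
  \<open>h\<close>; at a large \<open>d x y\<close> the gap forbids this.\<close>

lemma near_minimal_Cauchy:
  assumes "\<epsilon> > 0"
  obtains h where "h > 0" "\<And>x y. \<lbrakk>near_minimal h x; near_minimal h y\<rbrakk> \<Longrightarrow> d x y < \<rho> + \<epsilon>"
proof -
  obtain \<eta> where \<eta>: "\<eta> > 0" "\<And>t. t \<ge> \<epsilon> \<Longrightarrow> \<phi> t \<le> t - \<eta>"
    using gap[OF assms] by blast
  \<comment> \<open>The errors are \<open>2 * h\<close> in \<open>contr_M\<close> and
    \<open>4 * h\<close> for returning from the images to \<open>x\<close> and \<open>y\<close>:
    \<open>6 * h\<close> against \<open>\<eta>\<close>. In the self-mean case they are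
    \<open>h + 4 * h\<close> against \<open>\<epsilon>\<close>.\<close>
  define h where "h = min \<eta> \<epsilon> / 7"
  have h: "h > 0" "6 * h < \<eta>" "5 * h < \<epsilon>"
    using \<eta>(1) assms by (auto simp: h_def)
  have "d x y < \<rho> + \<epsilon>" if "near_minimal h x" "near_minimal h y" for x y
  proof (rule ccontr)
    assume far: "\<not> d x y < \<rho> + \<epsilon>"
    note x = near_minimalD[OF that(1)] and y = near_minimalD[OF that(2)]
    have X: "x \<in> X" "y \<in> X" "T x \<in> X" "T y \<in> X" using x(1) y(1) by auto
    have "d x (T y) \<le> d x y + 2 * h" "d (T x) y \<le> d x y + 2 * h"
      using triangle[of x y "T y"] triangle[of "T x" x y] commute[of "T x" x] X x y by linarith+
    moreover have "d x (T x) \<le> d x y + 2 * h" "d y (T y) \<le> d x y + 2 * h"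
      using x y far h by linarith+
    ultimately have "contr_M d T x y \<le> d x y + 2 * h"
      using h(1) by (auto simp: contr_M_def contr_M1_def contr_M2_def)
    moreover have "d x y \<le> contr_M d T x y"
      by (auto simp: contr_M_def contr_M1_def)
    ultimately have "\<phi> (contr_M d T x y) \<le> d x y + 2 * h - \<eta>"
      using \<eta>(2)[of "contr_M d T x y"] far \<rho>_nonneg by linarith
    moreover have "self_mean d x y \<le> \<rho> + h"
      using x y by (simp add: self_mean_def)
    moreover have "d x y \<le> d (T x) (T y) + 4 * h"
      using triangle[of x "T x" y] triangle[of "T x" "T y" y] commute[of "T y" y] X x y by linarith
    ultimately show False
      using contraction[OF X(1,2)] far h by linarith
  qed
  with that h(1) show thesis by blast
qed

text \<open>The limit \<open>u\<close> of increasingly near-minimal points inherits their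
  self-distance. If \<open>d u (T u)\<close> exceeded \<rho>, the contraction condition at
  \<open>u\<close> and a near-minimal point close to it would violate the gap.\<close>

lemma minimal_point_exists:
  assumes "Metric_space.mcomplete X (assoc_metric X d)"
  obtains u where "u \<in> X" "d u u = \<rho>" "d u (T u) = \<rho>"
proof -
  interpret E: Metric_space X "assoc_metric X d"
    by (rule Metric_space_assoc_metric)
  obtain v where v: "\<And>n. near_minimal (inverse (real (Suc n))) (v n)"
    using near_minimal_exists[of "inverse (real (Suc n))" for n]
    by (metis inverse_positive_iff_positive of_nat_0_less_iff zero_less_Suc)
  have near: "\<forall>\<^sub>F n in sequentially. near_minimal h (v n)" if "h > 0" for h
    using order_tendstoD(2)[OF LIMSEQ_inverse_real_of_nat that]
    by eventually_elim (rule near_minimal_mono[OF v less_imp_le])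
  have vX: "v n \<in> X" for n
    using v near_minimalD(1) by blast
  have "E.MCauchy v"
    unfolding E.MCauchy_def
  proof (intro conjI allI impI)
    fix \<epsilon> :: real assume "\<epsilon> > 0"
    \<comment> \<open>Twice the excess \<open>\<epsilon> / 4\<close> of \<open>d\<close> over
      \<rho>, plus a deficit of at most \<open>\<epsilon> / 4\<close> in each self-distance, adds up
      to \<epsilon>.\<close>
    then obtain h where h: "h > 0"
        "\<And>x y. \<lbrakk>near_minimal h x; near_minimal h y\<rbrakk> \<Longrightarrow> d x y < \<rho> + \<epsilon> / 4"
      using near_minimal_Cauchy[of "\<epsilon> / 4"] by auto
    obtain N where N: "\<And>n. n \<ge> N \<Longrightarrow> near_minimal (min h (\<epsilon> / 4)) (v n)"
      using near[of "min h (\<epsilon> / 4)"] h(1) \<open>\<epsilon> > 0\<close> by (auto simp: eventually_sequentially)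
    show "\<exists>N. \<forall>n n'. N \<le> n \<longrightarrow> N \<le> n' \<longrightarrow> assoc_metric X d (v n) (v n') < \<epsilon>"
    proof (intro exI allI impI)
      fix n m assume "N \<le> n" "N \<le> m"
      then have "near_minimal h (v n)" "near_minimal h (v m)"
          "near_minimal (\<epsilon> / 4) (v n)" "near_minimal (\<epsilon> / 4) (v m)"
        using N near_minimal_mono by (meson min.cobounded1 min.cobounded2)+
      then show "assoc_metric X d (v n) (v m) < \<epsilon>"
        using h(2)[of "v n" "v m"] near_minimalD(2)[of "\<epsilon> / 4" "v n"]
          near_minimalD(2)[of "\<epsilon> / 4" "v m"] vX
        by (simp add: assoc_metric_def)
    qed
  qed (use vX in auto)
  then obtain u where "limitin E.mtopology v u sequentially"
    using assms unfolding E.mcomplete_def by blast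
  then have u: "u \<in> X"
      "\<And>\<epsilon>. \<epsilon> > 0 \<Longrightarrow> \<forall>\<^sub>F n in sequentially. assoc_metric X d (v n) u < \<epsilon>"
    by (auto simp: E.limitin_metric elim: eventually_mono)
  \<comment> \<open>The associated distance is the sum of the two nonnegative differences, so each
    is small with it.\<close>
  have "\<exists>x. near_minimal h x \<and> d x u - d x x < h \<and> d x u - d u u < h" if h: "h > 0" for h
  proof -
    have "\<forall>\<^sub>F n in sequentially. near_minimal h (v n) \<and> assoc_metric X d (v n) u < h"
      using near[OF h] u(2)[OF h] by eventually_elim simp
    then obtain n where n: "near_minimal h (v n)" "assoc_metric X d (v n) u < h"
      by (auto simp: eventually_sequentially)
    then show ?thesis
      using self_le[of "v n" u] vX[of n] u(1) by (auto simp: assoc_metric_def intro!: exI[of _ "v n"])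
  qed
  then have approx: thesis
    if "h > 0" "\<And>x. \<lbrakk>near_minimal h x; d x u < d x x + h; d x u < d u u + h\<rbrakk> \<Longrightarrow> thesis"
    for h thesis
    using that by (smt (verit))
  have "\<bar>d u u - \<rho>\<bar> \<le> 0 + h" if "h > 0" for h
  proof (rule approx[of "h / 2"])
    fix x assume x: "near_minimal (h / 2) x" "d x u < d x x + h / 2" "d x u < d u u + h / 2"
    then show "\<bar>d u u - \<rho>\<bar> \<le> 0 + h"
      using near_minimalD[OF x(1)] self_le[of x u] u(1) by linarith
  qed (use that in simp)
  then have uu: "d u u = \<rho>"
    using field_le_epsilon[of "\<bar>d u u - \<rho>\<bar>" 0] by simp
  have "d u (T u) \<le> \<rho>"
  proof (rule ccontr)
    assume "\<not> d u (T u) \<le> \<rho>"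
    define D where "D = d u (T u)"
    have D: "D > \<rho>" "D > 0"
      using \<open>\<not> d u (T u) \<le> \<rho>\<close> \<rho>_nonneg by (auto simp: D_def)
    obtain \<eta> where \<eta>: "\<eta> > 0" "\<And>t. t \<ge> D \<Longrightarrow> \<phi> t \<le> t - \<eta>"
      using gap[OF D(2)] by blast
    \<comment> \<open>The errors below total \<open>2 * h + 3 * h\<close> against
      \<open>\<eta>\<close>, and \<open>h + 3 * h\<close> against \<open>D - \<rho>\<close> in the
      self-mean case.\<close>
    define h where "h = min \<eta> (D - \<rho>) / 7"
    have h: "h > 0" "6 * h < \<eta>" "5 * h < D - \<rho>"
      using \<eta>(1) D by (auto simp: h_def min_def)
    obtain x where x: "near_minimal h x" "d x u < d x x + h" "d x u < \<rho> + h"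
      using approx[OF h(1)] uu by metis
    note near_minimalD[OF x(1)]
    note x = x(2-) this
    have X: "x \<in> X" "T x \<in> X" "T u \<in> X"
      using x u(1) by auto
    have "d x (T u) \<le> D + h" "d (T x) u \<le> \<rho> + 3 * h"
      using triangle[of x u "T u"] triangle[of "T x" x u] commute[of x "T x"] x X u(1) uu
      unfolding D_def by linarith+
    with x h have "contr_M d T x u \<le> D + 2 * h"
      by (auto simp: contr_M_def contr_M1_def contr_M2_def D_def[symmetric])
    moreover have "D \<le> contr_M d T x u"
      by (auto simp: contr_M_def contr_M1_def D_def)
    ultimately have "\<phi> (contr_M d T x u) \<le> D + 2 * h - \<eta>"
      using \<eta>(2)[of "contr_M d T x u"] by linarith
    moreover have "self_mean d x u \<le> \<rho> + h"
      using x uu h by (simp add: self_mean_def)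
    moreover have "D \<le> d (T x) (T u) + 3 * h"
      using triangle[of u x "T u"] triangle[of x "T x" "T u"] commute[of u x] X u(1) x
      unfolding D_def by linarith
    ultimately show False
      using contraction[OF X(1) u(1)] h by linarith
  qed
  with that[OF u(1) uu] \<rho>_le[OF u(1)] show thesis
    by simp
qed

section \<open>Existence and uniqueness of the fixed point\<close>

lemma fixed_point_exists:
  assumes "Metric_space.mcomplete X (assoc_metric X d)"
  obtains u where "u \<in> X" "T u = u"
proof -
  obtain u where u: "u \<in> X" "d u u = \<rho>" "d u (T u) = \<rho>"
    using minimal_point_exists[OF assms] .
  have "d (T u) (T u) = \<rho>"
  proof (cases "\<rho> = 0")
    case True
    then show ?thesis
      using self_le(2)[of u "T u"] nonneg[of "T u" "T u"] u by simp
  next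
    \<comment> \<open>The step at \<open>T u\<close> is at least \<rho> by minimality, and
      \<open>\<phi> \<rho>\<close> is too small to bound it. So the mean of \<rho> and
      \<open>d (T u) (T u)\<close> is at least \<rho>.\<close>
    case False
    then have "\<phi> \<rho> < \<rho>"
      using \<phi>_less \<rho>_nonneg by simp
    then show ?thesis
      using \<rho>_le[of "T u"] iterate_contraction[OF u(1)] self_le(2)[of u "T u"] u
      by (simp add: self_mean_def max_def split: if_splits)
  qed
  then show thesis
    using eq_self[of u "T u"] u that[of u] by simp
qed

text \<open>At two fixed points \<open>contr_M\<close> collapses to \<open>d x y\<close>, so the
  self-mean must bound \<open>d x y\<close>. Neither self-distance exceeds \<open>d x y\<close>,
  hence both equal it.\<close>

lemma fixed_point_unique:
  assumes "x \<in> X" "y \<in> X" "T x = x" "T y = y"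
  shows "x = y"
proof -
  have self: "d x x \<le> d x y" "d y y \<le> d x y"
    using self_le assms by auto
  then have "contr_M d T x y = d x y"
    using assms by (auto simp: contr_M_def contr_M1_def contr_M2_def)
  then have "d x y \<le> self_mean d x y"
    using contraction[of x y] assms \<phi>_less[of "d x y"] \<phi>_0 nonneg[of x x] nonneg[of y y] nonneg[of x y]
    by (cases "d x y = 0") (auto simp: self_mean_def max_def split: if_splits)
  with self show ?thesis
    using assms by (intro eq_self) (auto simp: self_mean_def)
qed

end

theorem theorem2:
  fixes X :: "'a set" and d :: "'a \<Rightarrow> 'a \<Rightarrow> real" and T :: "'a \<Rightarrow> 'a" and \<phi> :: "real \<Rightarrow> real"
  assumes "X \<noteq> {}"
    and "Partial_metric_space X d"
    and "Metric_space.mcomplete X (assoc_metric X d)"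
    and "T \<in> X \<rightarrow> X"
    and "limit_normal \<phi>"
    and "semi_coercive (\<lambda>t. t - \<phi> t)"
    and "\<And>x y. \<lbrakk>x \<in> X; y \<in> X\<rbrakk> \<Longrightarrow> d (T x) (T y) \<le> max (\<phi> (contr_M d T x y)) (self_mean d x y)"
  shows "is_singleton {z \<in> X. z = T z}"
proof -
  interpret Partial_metric_contraction X d T \<phi>
    using assms by (intro Partial_metric_contraction.intro Partial_metric_contraction_axioms.intro) auto
  obtain u where "u \<in> X" "T u = u"
    using fixed_point_exists[OF assms(3)] .
  then show ?thesis
    using fixed_point_unique by (intro is_singletonI') auto
qed

end
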